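(* Let $n\ge 1$ and let $A$ be a real $n\times n$ matrix. Then $A$ is a Markov matrix if and only if $AX\in S2_n$ for every $X\in S2_n$.
   Context: A real $n\times n$ matrix $A=(a_{ij})$ is called a Markov matrix if $a_{ij}\ge 0$ for all $1\le i,j\le n$ and $\sum_{i=1}^n a_{ij}=1$ for every $1\le j\le n$ (each column sums to $1$). It acts on column vectors by $X\mapsto AX$. Notation: $S2_n=\{X=(x_1,\dots,x_n)^T\in\mathbb{R}^n : \sum_{i=1}^n x_i=1,\ x_i\ge 0 \text{ for all } 1\le i\le n\}$. *)

theory Defs
  imports "HOL-Analysis.Analysis"
begin

(* A $ i $ j is the entry in row i and column j, so the sum over i is a column sum. *)
definition Markov_matrix :: "real ^ 'n ^ 'n \<Rightarrow> bool" where
  "Markov_matrix A \<longleftrightarrow> (\<forall>i j. A $ i $ j \<ge> 0) \<and> (\<forall>j. (\<Sum>i\<in>UNIV. A $ i $ j) = 1)"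

definition S2 :: "(real ^ 'n) set" where
  "S2 = {X. (\<Sum>i\<in>UNIV. X $ i) = 1 \<and> (\<forall>i. X $ i \<ge> 0)}"

end

theory Submission
  imports Defs
begin

text \<open>\<open>S2\<close> is the standard simplex; its vertices are the basis vectors, and
  \<open>A\<close> sends them to its columns. If \<open>A\<close> preserves \<open>S2\<close>, every
  column therefore lies in \<open>S2\<close>, which is exactly the Markov condition. Conversely,
  nonnegative entries preserve nonnegativity, and \<open>sum_matrix_vector_mult\<close> shows that
  unit column sums preserve the coordinate sum.\<close>

lemma axis_in_S2: "axis j 1 \<in> S2"
  by (simp add: S2_def axis_def)

text \<open>Swapping the two finite sums makes the column sums of \<open>A\<close> appear as the
  coefficients of \<open>X\<close>.\<close>

lemma sum_matrix_vector_mult: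
  fixes A :: "'a::comm_semiring_1 ^ 'n ^ 'm"
  shows "(\<Sum>i\<in>UNIV. (A *v X) $ i) = (\<Sum>j\<in>UNIV. (\<Sum>i\<in>UNIV. A $ i $ j) * X $ j)"
  unfolding matrix_vector_mult_def
  by (simp add: sum_distrib_right) (rule sum.swap)

theorem theorem7:
  fixes A :: "real ^ 'n ^ 'n"
  shows "Markov_matrix A \<longleftrightarrow> (\<forall>X\<in>S2. A *v X \<in> S2)"
proof
  assume A: "Markov_matrix A"
  show "\<forall>X\<in>S2. A *v X \<in> S2"
  proof
    fix X :: "real ^ 'n"
    assume X: "X \<in> S2"
    have "(\<Sum>i\<in>UNIV. (A *v X) $ i) = 1"
      using A X by (simp add: sum_matrix_vector_mult Markov_matrix_def S2_def)
    moreover have "(A *v X) $ i \<ge> 0" for i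
      using A X by (auto simp: matrix_vector_mult_def Markov_matrix_def S2_def intro!: sum_nonneg)
    ultimately show "A *v X \<in> S2"
      by (simp add: S2_def)
  qed
next
  assume "\<forall>X\<in>S2. A *v X \<in> S2"
  \<comment> \<open>Test the hypothesis on the vertex \<open>axis j 1\<close>, whose image is column
    \<open>j\<close>.\<close>
  then have "column j A \<in> S2" for j
    using axis_in_S2[of j] by (metis matrix_vector_mult_basis)
  then show "Markov_matrix A"
    by (simp add: Markov_matrix_def S2_def column_def)
qed

end
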